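(* For every integer $r\ge 3$, the first Betti number of the group $K_r$ (defined by the finite presentation in the context) is $b_1(K_r)=4r-2$.
   Context: Commutators are $[x,y]=xyx^{-1}y^{-1}$; a relator $w$ stands for $w=1$; $b_1(K)$ is the rank of $H_1(K,\mathbb{Z})$. Words: $V_{i,j,1}=1$ if $i=j$ and $V_{i,j,1}=d^{2i-3}$ if $i\neq j$; $W_{i,i,1}=[f_i^{(2)},c_i^{-1}]$ and $W_{i,j,1}=f_i^{(2)}c_j^{-1}(f_i^{(2)})^{-1}d^{2i-3}c_j$ if $i\ne j$; $S^{(k)}=(f_1^{(k)})^{-1}(f_2^{(k)})^{-1}d f_1^{(k)}f_2^{(k)}$; $T^{(k)}=(c_1g_1^{(k)})^{-1}(c_2g_2^{(k)})^{-1}d\,c_1g_1^{(k)}c_2g_2^{(k)}$. For $r\ge4$, $K_r$ is generated by $c_i,d,f_i^{(k)},g_i^{(k)}$ ($k=2,\dots,r$, $i=1,2$) subject to the relators, for all $i,j\in\{1,2\}$, $\epsilon=\pm1$, $k,l\in\{2,\dots,r\}$, $l\ne k$: $(f_i^{(k)})^{\epsilon}c_j(f_i^{(k)})^{-\epsilon}(f_i^{(l)})^{\epsilon}c_j^{-1}(f_i^{(l)})^{-\epsilon}$; $(f_i^{(k)})^{\epsilon}d(f_i^{(k)})^{-\epsilon}(f_i^{(l)})^{\epsilon}d^{-1}(f_i^{(l)})^{-\epsilon}$; $[[f_1^{(r)},f_2^{(r)}],d]$; $[c_i,g_j^{(k)}][c_j^{-1}f_j^{(k)},c_i]$; $[f_i^{(k)},f_j^{(l)}]V_{i,j,1}^{-1}$;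 $[f_i^{(k)},g_j^{(l)}]W_{i,j,1}^{-1}$; $[c_ig_i^{(k)},c_jg_j^{(l)}]V_{i,j,1}^{-1}$; $d^{-1}c_1^{-1}f_1^{(k)}c_2^{-1}(f_1^{(k)})^{-1}d^{-1}f_2^{(k)}c_1(f_2^{(k)})^{-1}c_2$; $S^{(k)}T^{(k)}$. For $r=3$, $K_3$ is generated by $x_1,x_2$, $A=\{c_1,c_2,d,f_1^{(2)},f_2^{(2)},g_1^{(2)},g_2^{(2)}\}$ and $B=\{c_1^{(3)},c_2^{(3)},\delta\}$ subject to the relators, for all $i,j\in\{1,2\}$, $\epsilon=\pm1$: $x_i^{\epsilon}c_jx_i^{-\epsilon}(f_i^{(2)})^{\epsilon}c_j^{-1}(f_i^{(2)})^{-\epsilon}$; $x_i^{\epsilon}dx_i^{-\epsilon}(f_i^{(2)})^{\epsilon}d^{-1}(f_i^{(2)})^{-\epsilon}$; $[x_1,x_2]\delta d$; $[c_i,g_j^{(2)}][c_j^{-1}f_j^{(2)},c_i]$; $[x_i,f_j^{(2)}]V_{i,j,1}^{-1}$; $[x_i,g_j^{(2)}]W_{i,j,1}^{-1}$; $[a,b]$ for $a\in A,b\in B$; $d^{-1}c_1^{-1}f_1^{(2)}c_2^{-1}(f_1^{(2)})^{-1}d^{-1}f_2^{(2)}c_1(f_2^{(2)})^{-1}c_2$; $S^{(2)}T^{(2)}$; $\delta^{-2}x_2x_1[(x_1c_1^{(3)})^{-1},(x_2c_2^{(3)})^{-1}]x_2^{-1}x_1^{-1}$. *)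

theory Defs
  imports "HOL-Algebra.Free_Abelian_Groups" "HOL-Library.Extended_Nat"
begin

section \<open>Groups given by generators and relators\<close>

text \<open>A letter is a generator together with a sign: \<open>(x, True)\<close> stands for the generator \<open>x\<close> and
  \<open>(x, False)\<close> for its formal inverse.\<close>

type_synonym 'a word = "('a \<times> bool) list"

definition words :: "'a set \<Rightarrow> 'a word set" where
  "words X = lists (X \<times> UNIV)"

definition cancellation :: "'a set \<Rightarrow> ('a word \<times> 'a word) set" where
  "cancellation X =
     {(u @ [(x, s), (x, \<not> s)] @ v, u @ v) | u v x s. u \<in> words X \<and> v \<in> words X \<and> x \<in> X}"

definition free_rel :: "'a set \<Rightarrow> ('a word \<times> 'a word) set" where
  "free_rel X = (cancellation X \<union> (cancellation X)\<inverse>)\<^sup>* \<inter> words X \<times> words X"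

definition word_class :: "'a set \<Rightarrow> 'a word \<Rightarrow> 'a word set" where
  "word_class X w = free_rel X `` {w}"

definition free_group :: "'a set \<Rightarrow> 'a word set monoid" where
  "free_group X =
     \<lparr>carrier = words X // free_rel X,
      mult = (\<lambda>A B. \<Union>u\<in>A. \<Union>v\<in>B. word_class X (u @ v)),
      one = word_class X []\<rparr>"

definition normal_closure :: "('a, 'm) monoid_scheme \<Rightarrow> 'a set \<Rightarrow> 'a set" where
  "normal_closure G S = \<Inter>{N. N \<lhd> G \<and> S \<subseteq> N}"

definition presented_group :: "'a set \<Rightarrow> 'a word set \<Rightarrow> 'a word set set monoid" where
  "presented_group X R =
     free_group X Mod normal_closure (free_group X) (word_class X ` R)"

definition winv :: "'a word \<Rightarrow> 'a word" where
  "winv w = rev (map (\<lambda>(x, s). (x, \<not> s)) w)"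

definition wpow :: "'a word \<Rightarrow> int \<Rightarrow> 'a word" where
  "wpow w n = (if n \<ge> 0 then concat (replicate (nat n) w)
               else concat (replicate (nat (- n)) (winv w)))"

definition wcomm :: "'a word \<Rightarrow> 'a word \<Rightarrow> 'a word" where
  "wcomm u v = u @ v @ winv u @ winv v"

section \<open>Integral group homology and Betti numbers\<close>

text \<open>Homology of \<open>G\<close> with trivial integer coefficients, computed from the (inhomogeneous) bar
  complex: \<open>n\<close>-chains are formal integer combinations of \<open>n\<close>-tuples of elements of \<open>G\<close>, and
  \<open>[g\<^sub>1|\<dots>|g\<^sub>n]\<close> has boundary \<open>[g\<^sub>2|\<dots>|g\<^sub>n] + (\<Sum>0<i<n. (-1)^i [\<dots>|g\<^sub>ig\<^sub>i\<^sub>+\<^sub>1|\<dots>])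
  + (-1)^n [g\<^sub>1|\<dots>|g\<^sub>n\<^sub>-\<^sub>1]\<close>.\<close>

definition bar_basis :: "nat \<Rightarrow> ('a, 'm) monoid_scheme \<Rightarrow> 'a list set" where
  "bar_basis n G = {gs. length gs = n \<and> set gs \<subseteq> carrier G}"

definition bar_chains :: "nat \<Rightarrow> ('a, 'm) monoid_scheme \<Rightarrow> ('a list \<Rightarrow>\<^sub>0 int) monoid" where
  "bar_chains n G = free_Abelian_group (bar_basis n G)"

definition bar_face :: "('a, 'm) monoid_scheme \<Rightarrow> nat \<Rightarrow> nat \<Rightarrow> 'a list \<Rightarrow> 'a list" where
  "bar_face G n i gs =
     (if i = 0 then tl gs
      else if i = n then butlast gs
      else take (i - 1) gs @ [gs ! (i - 1) \<otimes>\<^bsub>G\<^esub> gs ! i] @ drop (i + 1) gs)"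

definition bar_boundary ::
  "nat \<Rightarrow> ('a, 'm) monoid_scheme \<Rightarrow> ('a list \<Rightarrow>\<^sub>0 int) \<Rightarrow> ('a list \<Rightarrow>\<^sub>0 int)" where
  "bar_boundary n G =
     frag_extend (\<lambda>gs. if n = 0 then 0
                       else \<Sum>i\<le>n. frag_cmul ((-1) ^ i) (frag_of (bar_face G n i gs)))"

definition group_homology :: "nat \<Rightarrow> ('a, 'm) monoid_scheme \<Rightarrow> ('a list \<Rightarrow>\<^sub>0 int) set monoid" where
  "group_homology n G =
     (bar_chains n G)\<lparr>carrier := {z \<in> carrier (bar_chains n G). bar_boundary n G z = 0}\<rparr>
       Mod (bar_boundary (Suc n) G ` carrier (bar_chains (Suc n) G))"

definition int_independent :: "('a, 'm) monoid_scheme \<Rightarrow> 'a set \<Rightarrow> bool" where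
  "int_independent A S \<longleftrightarrow> finite S \<and> S \<subseteq> carrier A \<and>
     (\<forall>m :: 'a \<Rightarrow> int. finprod A (\<lambda>x. x [^]\<^bsub>A\<^esub> m x) S = \<one>\<^bsub>A\<^esub> \<longrightarrow> (\<forall>x\<in>S. m x = 0))"

definition abelian_rank :: "('a, 'm) monoid_scheme \<Rightarrow> enat" where
  "abelian_rank A = (SUP S\<in>{S. int_independent A S}. enat (card S))"

definition betti_number :: "nat \<Rightarrow> ('a, 'm) monoid_scheme \<Rightarrow> enat" where
  "betti_number n G = abelian_rank (group_homology n G)"

section \<open>The groups \<open>K r\<close>\<close>

text \<open>\<open>Gen_f i k\<close> is \<open>f\<^sub>i\<^sup>(\<^sup>k\<^sup>)\<close> and \<open>Gen_g i k\<close> is \<open>g\<^sub>i\<^sup>(\<^sup>k\<^sup>)\<close>. The last three constructors, standing for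
  \<open>x\<^sub>i\<close>, \<open>c\<^sub>i\<^sup>(\<^sup>3\<^sup>)\<close> and \<open>\<delta>\<close>, occur only in \<open>K 3\<close>.\<close>

datatype gen =
  Gen_c nat | Gen_d | Gen_f nat nat | Gen_g nat nat | Gen_x nat | Gen_c3 nat | Gen_delta

abbreviation cc :: "nat \<Rightarrow> gen word" where "cc i \<equiv> [(Gen_c i, True)]"
abbreviation dd :: "gen word" where "dd \<equiv> [(Gen_d, True)]"
abbreviation ff :: "nat \<Rightarrow> nat \<Rightarrow> gen word" where "ff i k \<equiv> [(Gen_f i k, True)]"
abbreviation gg :: "nat \<Rightarrow> nat \<Rightarrow> gen word" where "gg i k \<equiv> [(Gen_g i k, True)]"
abbreviation xx :: "nat \<Rightarrow> gen word" where "xx i \<equiv> [(Gen_x i, True)]"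
abbreviation cc3 :: "nat \<Rightarrow> gen word" where "cc3 i \<equiv> [(Gen_c3 i, True)]"
abbreviation delta :: "gen word" where "delta \<equiv> [(Gen_delta, True)]"

definition V_word :: "nat \<Rightarrow> nat \<Rightarrow> gen word" where
  "V_word i j = (if i = j then [] else wpow dd (2 * int i - 3))"

definition W_word :: "nat \<Rightarrow> nat \<Rightarrow> gen word" where
  "W_word i j =
     (if i = j then wcomm (ff i 2) (winv (cc i))
      else ff i 2 @ winv (cc j) @ winv (ff i 2) @ wpow dd (2 * int i - 3) @ cc j)"

definition S_word :: "nat \<Rightarrow> gen word" where
  "S_word k = winv (ff 1 k) @ winv (ff 2 k) @ dd @ ff 1 k @ ff 2 k"

definition T_word :: "nat \<Rightarrow> gen word" where
  "T_word k = winv (cc 1 @ gg 1 k) @ winv (cc 2 @ gg 2 k) @ dd @ cc 1 @ gg 1 k @ cc 2 @ gg 2 k"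

definition gens_ge4 :: "nat \<Rightarrow> gen set" where
  "gens_ge4 r = {Gen_c i | i. i \<in> {1,2}} \<union> {Gen_d}
     \<union> {Gen_f i k | i k. i \<in> {1,2} \<and> k \<in> {2..r}}
     \<union> {Gen_g i k | i k. i \<in> {1,2} \<and> k \<in> {2..r}}"

definition rels_ge4 :: "nat \<Rightarrow> gen word set" where
  "rels_ge4 r =
     {wpow (ff i k) \<epsilon> @ cc j @ wpow (ff i k) (- \<epsilon>) @ wpow (ff i l) \<epsilon> @ winv (cc j) @ wpow (ff i l) (- \<epsilon>)
        | i j k l \<epsilon>. i \<in> {1,2} \<and> j \<in> {1,2} \<and> k \<in> {2..r} \<and> l \<in> {2..r} \<and> l \<noteq> k \<and> \<epsilon> \<in> {1,-1}}
   \<union> {wpow (ff i k) \<epsilon> @ dd @ wpow (ff i k) (- \<epsilon>) @ wpow (ff i l) \<epsilon> @ winv dd @ wpow (ff i l) (- \<epsilon>)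
        | i k l \<epsilon>. i \<in> {1,2} \<and> k \<in> {2..r} \<and> l \<in> {2..r} \<and> l \<noteq> k \<and> \<epsilon> \<in> {1,-1}}
   \<union> {wcomm (wcomm (ff 1 r) (ff 2 r)) dd}
   \<union> {wcomm (cc i) (gg j k) @ wcomm (winv (cc j) @ ff j k) (cc i)
        | i j k. i \<in> {1,2} \<and> j \<in> {1,2} \<and> k \<in> {2..r}}
   \<union> {wcomm (ff i k) (ff j l) @ winv (V_word i j)
        | i j k l. i \<in> {1,2} \<and> j \<in> {1,2} \<and> k \<in> {2..r} \<and> l \<in> {2..r} \<and> l \<noteq> k}
   \<union> {wcomm (ff i k) (gg j l) @ winv (W_word i j)
        | i j k l. i \<in> {1,2} \<and> j \<in> {1,2} \<and> k \<in> {2..r} \<and> l \<in> {2..r} \<and> l \<noteq> k}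
   \<union> {wcomm (cc i @ gg i k) (cc j @ gg j l) @ winv (V_word i j)
        | i j k l. i \<in> {1,2} \<and> j \<in> {1,2} \<and> k \<in> {2..r} \<and> l \<in> {2..r} \<and> l \<noteq> k}
   \<union> {winv dd @ winv (cc 1) @ ff 1 k @ winv (cc 2) @ winv (ff 1 k) @ winv dd
        @ ff 2 k @ cc 1 @ winv (ff 2 k) @ cc 2
        | k. k \<in> {2..r}}
   \<union> {S_word k @ T_word k | k. k \<in> {2..r}}"

definition A_gens :: "gen set" where
  "A_gens = {Gen_c 1, Gen_c 2, Gen_d, Gen_f 1 2, Gen_f 2 2, Gen_g 1 2, Gen_g 2 2}"

definition B_gens :: "gen set" where
  "B_gens = {Gen_c3 1, Gen_c3 2, Gen_delta}"

definition gens_3 :: "gen set" where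
  "gens_3 = {Gen_x 1, Gen_x 2} \<union> A_gens \<union> B_gens"

definition rels_3 :: "gen word set" where
  "rels_3 =
     {wpow (xx i) \<epsilon> @ cc j @ wpow (xx i) (- \<epsilon>) @ wpow (ff i 2) \<epsilon> @ winv (cc j) @ wpow (ff i 2) (- \<epsilon>)
        | i j \<epsilon>. i \<in> {1,2} \<and> j \<in> {1,2} \<and> \<epsilon> \<in> {1,-1}}
   \<union> {wpow (xx i) \<epsilon> @ dd @ wpow (xx i) (- \<epsilon>) @ wpow (ff i 2) \<epsilon> @ winv dd @ wpow (ff i 2) (- \<epsilon>)
        | i \<epsilon>. i \<in> {1,2} \<and> \<epsilon> \<in> {1,-1}}
   \<union> {wcomm (xx 1) (xx 2) @ delta @ dd}
   \<union> {wcomm (cc i) (gg j 2) @ wcomm (winv (cc j) @ ff j 2) (cc i)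
        | i j. i \<in> {1,2} \<and> j \<in> {1,2}}
   \<union> {wcomm (xx i) (ff j 2) @ winv (V_word i j) | i j. i \<in> {1,2} \<and> j \<in> {1,2}}
   \<union> {wcomm (xx i) (gg j 2) @ winv (W_word i j) | i j. i \<in> {1,2} \<and> j \<in> {1,2}}
   \<union> {wcomm [(a, True)] [(b, True)] | a b. a \<in> A_gens \<and> b \<in> B_gens}
   \<union> {winv dd @ winv (cc 1) @ ff 1 2 @ winv (cc 2) @ winv (ff 1 2) @ winv dd
        @ ff 2 2 @ cc 1 @ winv (ff 2 2) @ cc 2}
   \<union> {S_word 2 @ T_word 2}
   \<union> {wpow delta (- 2) @ xx 2 @ xx 1 @ wcomm (winv (xx 1 @ cc3 1)) (winv (xx 2 @ cc3 2))
        @ winv (xx 2) @ winv (xx 1)}"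

text \<open>Only the values at \<open>r \<ge> 3\<close> are meaningful.\<close>

definition K :: "nat \<Rightarrow> gen word set set monoid" where
  "K r = (if r = 3 then presented_group gens_3 rels_3
          else presented_group (gens_ge4 r) (rels_ge4 r))"

end

theory Submission
  imports Defs
begin

text \<open>In the abelianization of \<open>K r\<close> the relators only say that \<open>d\<close> vanishes and, for \<open>r = 3\<close>, that \<open>\<delta>\<close>
  vanishes as well; every relator has exponent sum zero in the other \<open>4 r - 2\<close> generators. Counting
  exponents therefore maps the bar 1-chains of \<open>K r\<close> onto a free abelian group of rank \<open>4 r - 2\<close>.
  Modulo the boundaries \<open>[h] - [gh] + [g]\<close>, each 1-chain is the combination of generators recorded by
  its exponents, so the kernel of this map is exactly the group of boundaries.\<close>

section \<open>Words and free groups\<close>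

lemma words_Nil [simp]: "[] \<in> words X"
  by (simp add: words_def)

lemma words_append [simp]: "u @ v \<in> words X \<longleftrightarrow> u \<in> words X \<and> v \<in> words X"
  by (auto simp: words_def)

lemma words_Cons [simp]: "(x, s) # w \<in> words X \<longleftrightarrow> x \<in> X \<and> w \<in> words X"
  by (auto simp: words_def)

lemma winv_Nil [simp]: "winv [] = []"
  by (simp add: winv_def)

lemma winv_Cons [simp]: "winv ((x, s) # w) = winv w @ [(x, \<not> s)]"
  by (simp add: winv_def)

lemma winv_append [simp]: "winv (u @ v) = winv v @ winv u"
  by (simp add: winv_def)

lemma words_winv [simp]: "winv w \<in> words X \<longleftrightarrow> w \<in> words X"
  by (induction w) auto

lemma words_wpow [intro]: "w \<in> words X \<Longrightarrow> wpow w n \<in> words X"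
proof -
  assume w: "w \<in> words X"
  have "concat (replicate k u) \<in> words X" if "u \<in> words X" for u and k :: nat
    using that by (induction k) auto
  then show ?thesis
    using w by (simp add: wpow_def)
qed

lemma words_wcomm [simp]: "wcomm u v \<in> words X \<longleftrightarrow> u \<in> words X \<and> v \<in> words X"
  by (auto simp: wcomm_def)

section \<open>Free reduction as a congruence on words\<close>

lemma cancellation_words: "(u, v) \<in> cancellation X \<Longrightarrow> u \<in> words X \<and> v \<in> words X"
  by (auto simp: cancellation_def)

lemma cancellation_context:
  assumes "(u, v) \<in> cancellation X" "a \<in> words X" "b \<in> words X"
  shows "(a @ u @ b, a @ v @ b) \<in> cancellation X"
proof -
  obtain p q x s where "u = p @ [(x, s), (x, \<not> s)] @ q" "v = p @ q"
    "p \<in> words X" "q \<in> words X" "x \<in> X"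
    using assms(1) by (auto simp: cancellation_def)
  with assms(2,3) show ?thesis
    unfolding cancellation_def
    by (intro CollectI exI[of _ "a @ p"] exI[of _ "q @ b"] exI[of _ x] exI[of _ s]) auto
qed

lemma equiv_free_rel: "equiv (words X) (free_rel X)"
proof (rule equivI)
  show "refl_on (words X) (free_rel X)"
    by (auto simp: refl_on_def free_rel_def)
  have "sym ((cancellation X \<union> (cancellation X)\<inverse>)\<^sup>*)"
    by (intro sym_rtrancl) (auto simp: sym_def)
  then show "sym (free_rel X)"
    by (auto simp: free_rel_def sym_def)
  show "trans (free_rel X)"
    by (auto simp: free_rel_def trans_def)
qed (auto simp: free_rel_def)

text \<open>Each elementary move, an insertion or a deletion of an inverse pair, stays elementary
  inside a longer word; induction along the chain of moves does the rest. Two uses of this make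
  concatenation well defined on classes.\<close>

lemma free_rel_context:
  assumes "(u, v) \<in> free_rel X" and a: "a \<in> words X" and b: "b \<in> words X"
  shows "(a @ u @ b, a @ v @ b) \<in> free_rel X"
proof -
  have "(u, v) \<in> (cancellation X \<union> (cancellation X)\<inverse>)\<^sup>*"
    using assms(1) by (simp add: free_rel_def)
  then have "(a @ u @ b, a @ v @ b) \<in> (cancellation X \<union> (cancellation X)\<inverse>)\<^sup>*"
  proof induction
    case (step y z)
    then have "(a @ y @ b, a @ z @ b) \<in> cancellation X \<union> (cancellation X)\<inverse>"
      using cancellation_context a b by blast
    with step.IH show ?case
      by (rule rtrancl_into_rtrancl)
  qed simp
  with assms show ?thesis
    by (auto simp: free_rel_def)
qed

lemma free_rel_append:
  assumes "(u, u') \<in> free_rel X" "(v, v') \<in> free_rel X"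
  shows "(u @ v, u' @ v') \<in> free_rel X"
proof -
  have "(u @ v, u' @ v) \<in> free_rel X"
    using free_rel_context[OF assms(1), of "[]" v] assms(2) by (auto simp: free_rel_def)
  moreover have "(u' @ v, u' @ v') \<in> free_rel X"
    using free_rel_context[OF assms(2), of u' "[]"] assms(1) by (auto simp: free_rel_def)
  ultimately show ?thesis
    using equiv_free_rel[of X] by (meson equivE transE)
qed

section \<open>The free group as classes of words\<close>

lemma word_class_eq_iff:
  assumes "u \<in> words X" "v \<in> words X"
  shows "word_class X u = word_class X v \<longleftrightarrow> (u, v) \<in> free_rel X"
  unfolding word_class_def using assms eq_equiv_class_iff[OF equiv_free_rel] by blast

lemma carrier_free_group: "carrier (free_group X) = word_class X ` words X"
  by (auto simp: free_group_def quotient_def word_class_def)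

lemma word_class_carrier [simp]: "w \<in> words X \<Longrightarrow> word_class X w \<in> carrier (free_group X)"
  by (simp add: carrier_free_group)

lemma free_group_cases:
  assumes "A \<in> carrier (free_group X)"
  obtains w where "w \<in> words X" "A = word_class X w"
  using assms by (auto simp: carrier_free_group)

lemma one_free_group: "\<one>\<^bsub>free_group X\<^esub> = word_class X []"
  by (simp add: free_group_def)

lemma mult_free_group:
  assumes "u \<in> words X" "v \<in> words X"
  shows "word_class X u \<otimes>\<^bsub>free_group X\<^esub> word_class X v = word_class X (u @ v)"
proof -
  have eq: "word_class X (a @ b) = word_class X (u @ v)"
    if "a \<in> word_class X u" "b \<in> word_class X v" for a b
  proof -
    have "(u, a) \<in> free_rel X" "(v, b) \<in> free_rel X"
      using that by (auto simp: word_class_def)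
    then have "(u @ v, a @ b) \<in> free_rel X"
      by (rule free_rel_append)
    then show ?thesis
      by (subst eq_commute, subst word_class_eq_iff) (auto simp: free_rel_def)
  qed
  \<comment> \<open>The union below is indexed by the two classes; it collapses to its constant
    value because both are nonempty.\<close>
  have ne: "u \<in> word_class X u" "v \<in> word_class X v"
    using assms by (auto simp: word_class_def free_rel_def)
  have "word_class X u \<otimes>\<^bsub>free_group X\<^esub> word_class X v
      = (\<Union>a\<in>word_class X u. \<Union>b\<in>word_class X v. word_class X (a @ b))"
    by (simp add: free_group_def)
  also have "\<dots> = (\<Union>a\<in>word_class X u. \<Union>b\<in>word_class X v. word_class X (u @ v))"
    by (intro SUP_cong refl eq)
  also have "\<dots> = word_class X (u @ v)"
    using ne by blast
  finally show ?thesis .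
qed

text \<open>In \<open>winv (a # w) @ (a # w)\<close> the letter \<open>a\<close> and its inverse
  meet in the middle, so one cancellation leaves the same expression for \<open>w\<close>.\<close>

lemma free_rel_winv_left:
  assumes "w \<in> words X"
  shows "(winv w @ w, []) \<in> free_rel X"
  using assms
proof (induction w)
  case Nil
  then show ?case by (simp add: free_rel_def)
next
  case (Cons a w)
  obtain x s where a: "a = (x, s)" by force
  with Cons.prems have x: "x \<in> X" and w: "w \<in> words X" by auto
  have "(winv w @ [(x, \<not> s), (x, \<not> \<not> s)] @ w, winv w @ w) \<in> cancellation X"
    unfolding cancellation_def using x w
    by (intro CollectI exI[of _ "winv w"] exI[of _ w] exI[of _ x] exI[of _ "\<not> s"]) simp
  then have "(winv (a # w) @ (a # w), winv w @ w) \<in> cancellation X"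
    by (simp add: a)
  then have "(winv (a # w) @ (a # w), winv w @ w) \<in> free_rel X"
    using cancellation_words[of _ _ X] by (fastforce simp: free_rel_def)
  with Cons.IH[OF w] show ?case
    using equiv_free_rel[of X] by (meson equivE transE)
qed

lemma group_free_group: "group (free_group X)"
proof (rule groupI)
  fix A B C
  assume "A \<in> carrier (free_group X)" "B \<in> carrier (free_group X)" "C \<in> carrier (free_group X)"
  then show "A \<otimes>\<^bsub>free_group X\<^esub> B \<otimes>\<^bsub>free_group X\<^esub> C
      = A \<otimes>\<^bsub>free_group X\<^esub> (B \<otimes>\<^bsub>free_group X\<^esub> C)"
    by (elim free_group_cases) (simp add: mult_free_group)
next
  fix A assume "A \<in> carrier (free_group X)"
  then obtain w where w: "w \<in> words X" "A = word_class X w"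
    by (rule free_group_cases)
  have "word_class X (winv w) \<otimes>\<^bsub>free_group X\<^esub> A = \<one>\<^bsub>free_group X\<^esub>"
    using w free_rel_winv_left[of w X]
    by (simp add: mult_free_group one_free_group word_class_eq_iff)
  with w show "\<exists>B\<in>carrier (free_group X). B \<otimes>\<^bsub>free_group X\<^esub> A = \<one>\<^bsub>free_group X\<^esub>"
    by (intro bexI[of _ "word_class X (winv w)"]) simp_all
  show "\<one>\<^bsub>free_group X\<^esub> \<otimes>\<^bsub>free_group X\<^esub> A = A"
    using w by (simp add: one_free_group mult_free_group)
next
  fix A B assume "A \<in> carrier (free_group X)" "B \<in> carrier (free_group X)"
  then show "A \<otimes>\<^bsub>free_group X\<^esub> B \<in> carrier (free_group X)"
    by (elim free_group_cases) (simp add: mult_free_group)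
next
  show "\<one>\<^bsub>free_group X\<^esub> \<in> carrier (free_group X)"
    by (simp add: one_free_group)
qed

lemma inv_free_group:
  assumes "w \<in> words X"
  shows "inv\<^bsub>free_group X\<^esub> word_class X w = word_class X (winv w)"
  using assms free_rel_winv_left[of w X]
  by (simp add: group.inv_equality[OF group_free_group] mult_free_group one_free_group
      word_class_eq_iff)

text \<open>The homomorphism to an abelian group that extends the assignment \<open>v\<close> of
  generators. With \<open>v = frag_of\<close> it records all exponent sums; setting \<open>v\<close>
  to zero on some generators forgets their exponents.\<close>

primrec word_value :: "('a \<Rightarrow> 'b :: ab_group_add) \<Rightarrow> 'a word \<Rightarrow> 'b" where
  "word_value v [] = 0"
| "word_value v (a # w) = (if snd a then v (fst a) else - v (fst a)) + word_value v w"

lemma word_value_append [simp]: "word_value v (u @ w) = word_value v u + word_value v w"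
  by (induction u) (auto simp: algebra_simps)

lemma word_value_winv [simp]: "word_value v (winv w) = - word_value v w"
  by (induction w) auto

lemma word_value_wcomm [simp]: "word_value v (wcomm u w) = 0"
  by (simp add: wcomm_def)

lemma word_value_wpow_eq_0: "word_value v w = 0 \<Longrightarrow> word_value v (wpow w n) = 0"
proof -
  assume w: "word_value v w = 0"
  have "word_value v (concat (replicate k u)) = 0" if "word_value v u = 0" for u and k :: nat
    using that by (induction k) auto
  with w show ?thesis
    by (simp add: wpow_def)
qed

lemma word_value_free_rel:
  assumes "(u, w) \<in> free_rel X"
  shows "word_value v u = word_value v w"
proof -
  have "(u, w) \<in> (cancellation X \<union> (cancellation X)\<inverse>)\<^sup>*"
    using assms by (simp add: free_rel_def)
  then show ?thesis
    by induction (auto simp: cancellation_def)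
qed

lemma keys_word_value:
  fixes v :: "'a \<Rightarrow> ('b \<Rightarrow>\<^sub>0 int)"
  assumes "\<And>x. Poly_Mapping.keys (v x) \<subseteq> I"
  shows "Poly_Mapping.keys (word_value v w) \<subseteq> I"
proof (induction w)
  case (Cons a w)
  then show ?case
    using assms[of "fst a"] keys_add[of "v (fst a)" "word_value v w"]
      keys_add[of "- v (fst a)" "word_value v w"]
    by (auto simp: keys_minus)
qed simp

text \<open>Naturality: evaluating in the free abelian group first and then extending linearly is
  the same as evaluating directly.\<close>

lemma frag_extend_word_value:
  "frag_extend f (word_value v w) = word_value (\<lambda>x. frag_extend f (v x)) w"
  by (induction w) (auto simp: frag_extend_add frag_extend_minus frag_extend_diff)

section \<open>Presented groups\<close>

lemma normal_normal_closure:
  assumes "group G" "S \<subseteq> carrier G"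
  shows "normal_closure G S \<lhd> G"
proof -
  interpret group G by fact
  \<comment> \<open>The whole group ensures that the family being intersected is nonempty.\<close>
  have car: "carrier G \<lhd> G"
    by (simp add: normal_inv_iff subgroup_self)
  let ?C = "{N. N \<lhd> G \<and> S \<subseteq> N}"
  have "subgroup (\<Inter>?C) G"
    using car assms(2) by (intro subgroups_Inter) (auto intro: normal_imp_subgroup)
  then show ?thesis
    unfolding normal_closure_def by (auto simp: normal_inv_iff)
qed

lemma normal_closure_least: "\<lbrakk>N \<lhd> G; S \<subseteq> N\<rbrakk> \<Longrightarrow> normal_closure G S \<subseteq> N"
  by (auto simp: normal_closure_def)

lemma normal_closure_superset: "S \<subseteq> normal_closure G S"
  by (auto simp: normal_closure_def)

text \<open>The canonical map from words to the presented group. Computations with group elements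
  are carried out on representing words.\<close>

definition pclass :: "'a set \<Rightarrow> 'a word set \<Rightarrow> 'a word \<Rightarrow> 'a word set set" where
  "pclass X R w =
     normal_closure (free_group X) (word_class X ` R) #>\<^bsub>free_group X\<^esub> word_class X w"

locale presentation =
  fixes X :: "'a set" and R :: "'a word set"
  assumes relators: "R \<subseteq> words X"
begin

abbreviation "N \<equiv> normal_closure (free_group X) (word_class X ` R)"
abbreviation "P \<equiv> presented_group X R"

lemma normal_N: "N \<lhd> free_group X"
  using relators by (intro normal_normal_closure group_free_group) (auto simp: carrier_free_group)

lemma group_P: "group P"
  unfolding presented_group_def by (rule normal.factorgroup_is_group[OF normal_N])

lemma carrier_P: "carrier P = pclass X R ` words X"
  by (simp add: presented_group_def carrier_FactGroup carrier_free_group image_image pclass_def)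

lemma pclass_carrier [simp]: "w \<in> words X \<Longrightarrow> pclass X R w \<in> carrier P"
  by (simp add: carrier_P)

lemma one_P: "\<one>\<^bsub>P\<^esub> = pclass X R []"
  using group.coset_mult_one[OF group_free_group normal.axioms(1)[OF normal_N, THEN subgroup.subset]]
  by (simp add: presented_group_def pclass_def flip: one_free_group)

lemma mult_P:
  assumes "u \<in> words X" "w \<in> words X"
  shows "pclass X R u \<otimes>\<^bsub>P\<^esub> pclass X R w = pclass X R (u @ w)"
  using assms normal.rcos_sum[OF normal_N, of "word_class X u" "word_class X w"]
  by (simp add: presented_group_def pclass_def mult_free_group carrier_free_group)

lemma pclass_relator:
  assumes "w \<in> R"
  shows "pclass X R w = \<one>\<^bsub>P\<^esub>"
proof -
  have "word_class X w \<in> N"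
    using normal_closure_superset[of "word_class X ` R" "free_group X"] assms by (simp add: subset_iff)
  then show ?thesis
    unfolding pclass_def presented_group_def one_FactGroup
    by (rule subgroup.rcos_const[OF normal_imp_subgroup[OF normal_N] group_free_group])
qed

lemma pclass_concat_relators:
  assumes "ws \<in> lists R"
  shows "concat ws \<in> words X" "pclass X R (concat ws) = \<one>\<^bsub>P\<^esub>"
proof -
  have "concat ws \<in> words X \<and> pclass X R (concat ws) = \<one>\<^bsub>P\<^esub>"
    using assms
  proof (induction ws)
    case (Cons w ws)
    then have "w \<in> words X" "pclass X R w = \<one>\<^bsub>P\<^esub>"
      using relators pclass_relator[of w] by auto
    with Cons show ?case
      using mult_P[of w "concat ws"] group_P by (auto simp: group.is_monoid)
  qed (simp add: one_P)
  then show "concat ws \<in> words X" "pclass X R (concat ws) = \<one>\<^bsub>P\<^esub>" by auto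
qed

text \<open>This makes exponent counting well defined on the presented group: an evaluation that
  vanishes on the relators vanishes on their normal closure.\<close>

lemma word_value_pclass_cong:
  fixes v :: "'a \<Rightarrow> ('b \<Rightarrow>\<^sub>0 int)"
  assumes rel: "\<And>w. w \<in> R \<Longrightarrow> word_value v w = 0"
    and u: "u \<in> words X" and w: "w \<in> words X" and eq: "pclass X R u = pclass X R w"
  shows "word_value v u = word_value v w"
proof -
  let ?F = "free_group X"
  \<comment> \<open>\<open>M\<close> is the kernel of the homomorphism that
    \<open>word_value v\<close> induces on the free group.\<close>
  define M where "M = word_class X ` {w \<in> words X. word_value v w = 0}"
  have M_iff: "word_class X w \<in> M \<longleftrightarrow> word_value v w = 0" if "w \<in> words X" for w
    using that word_value_free_rel[where v = v] by (auto simp: M_def word_class_eq_iff)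
  have M_cases: thesis
    if "A \<in> M" "\<And>w. \<lbrakk>w \<in> words X; word_value v w = 0; A = word_class X w\<rbrakk> \<Longrightarrow> thesis" for A thesis
    using that by (auto simp: M_def)
  have "subgroup M ?F"
  proof (rule group.subgroupI[OF group_free_group])
    show "M \<subseteq> carrier ?F"
      by (auto simp: M_def carrier_free_group)
    show "M \<noteq> {}"
      using M_iff[of "[]"] by auto
  next
    fix A assume "A \<in> M"
    then show "inv\<^bsub>?F\<^esub> A \<in> M"
      by (rule M_cases) (simp add: inv_free_group M_iff)
  next
    fix A B assume "A \<in> M" "B \<in> M"
    then show "A \<otimes>\<^bsub>?F\<^esub> B \<in> M"
      by (elim M_cases) (simp add: mult_free_group M_iff)
  qed
  \<comment> \<open>Conjugation does not change the value, because the target is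
    commutative.\<close>
  moreover have "A \<otimes>\<^bsub>?F\<^esub> B \<otimes>\<^bsub>?F\<^esub> inv\<^bsub>?F\<^esub> A \<in> M" if "A \<in> carrier ?F" "B \<in> M" for A B
    using that by (elim M_cases free_group_cases) (simp add: mult_free_group inv_free_group M_iff)
  ultimately have "M \<lhd> ?F"
    by (simp add: group.normal_inv_iff[OF group_free_group])
  moreover have "word_class X ` R \<subseteq> M"
    using relators rel by (auto simp: M_def)
  ultimately have NM: "N \<subseteq> M"
    by (rule normal_closure_least)
  \<comment> \<open>Equal cosets: \<open>u\<close> is freely equal to \<open>m @ w\<close> with the
    class of \<open>m\<close> in the normal closure, and such an \<open>m\<close> has value
    zero.\<close>
  have "word_class X u \<in> N #>\<^bsub>?F\<^esub> word_class X w"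
    using eq group.rcos_self[OF group_free_group _ normal_imp_subgroup[OF normal_N], of "word_class X u"] u
    by (auto simp: pclass_def carrier_free_group)
  then obtain n where "n \<in> N" "word_class X u = n \<otimes>\<^bsub>?F\<^esub> word_class X w"
    by (auto simp: r_coset_def)
  moreover then obtain m where m: "m \<in> words X" "n = word_class X m"  "word_value v m = 0"
    using NM by (auto simp: M_def)
  ultimately have "word_class X u = word_class X (m @ w)"
    using w by (simp add: mult_free_group)
  then have "word_value v u = word_value v (m @ w)"
    using u w m by (intro word_value_free_rel[of _ _ X]) (auto simp: word_class_eq_iff)
  then show ?thesis
    using m by simp
qed

end

section \<open>Ranks of free abelian groups\<close>

text \<open>A homogeneous system with more unknowns than equations has a nontrivial integer
  solution. The proof is fraction-free Gaussian elimination, by induction on the set of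
  equations.\<close>

lemma exists_integer_relation:
  fixes a :: "'s \<Rightarrow> 'i \<Rightarrow> int"
  assumes "finite I" "finite S" "card I < card S"
  shows "\<exists>m. (\<exists>s\<in>S. m s \<noteq> 0) \<and> (\<forall>i\<in>I. (\<Sum>s\<in>S. m s * a s i) = 0)"
  using assms
proof (induction I arbitrary: S a rule: finite_induct)
  case empty
  then have "S \<noteq> {}" by auto
  then show ?case by (intro exI[of _ "\<lambda>_. 1"]) auto
next
  case (insert j I)
  show ?case
  proof (cases "\<forall>s\<in>S. a s j = 0")
    case True
    have "card I < card S" using insert by simp
    with insert.IH[of S a] insert.prems obtain m where
      "\<exists>s\<in>S. m s \<noteq> 0" "\<forall>i\<in>I. (\<Sum>s\<in>S. m s * a s i) = 0"
      by blast
    with True show ?thesis by (intro exI[of _ m]) auto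
  next
    case False
    then obtain t where t: "t \<in> S" "a t j \<noteq> 0" by blast
    let ?S = "S - {t}"
    have "card I < card ?S" "finite ?S"
      using insert t by (auto simp: card_Diff_singleton)
    \<comment> \<open>These are the coefficients after the unknown \<open>t\<close> is eliminated by
      equation \<open>j\<close>. Multiplying by the pivot \<open>a t j\<close> instead of dividing
      by it keeps them integral.\<close>
    with insert.IH[of ?S "\<lambda>s i. a t j * a s i - a s j * a t i"] obtain m where
      m: "\<exists>s\<in>?S. m s \<noteq> 0"
         "\<forall>i\<in>I. (\<Sum>s\<in>?S. m s * (a t j * a s i - a s j * a t i)) = 0"
      by blast
    \<comment> \<open>Scaling the other entries by the pivot lets equation \<open>j\<close> be
      solved for the entry at \<open>t\<close> in integers.\<close>
    define m' where "m' = (\<lambda>s. if s = t then - (\<Sum>s\<in>?S. m s * a s j) else m s * a t j)"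
    have sum: "(\<Sum>s\<in>S. m' s * a s i)
        = (\<Sum>s\<in>?S. m s * (a t j * a s i - a s j * a t i))" for i
    proof -
      have "(\<Sum>s\<in>S. m' s * a s i) = m' t * a t i + (\<Sum>s\<in>?S. m' s * a s i)"
        using t insert.prems by (simp add: sum.remove)
      also have "(\<Sum>s\<in>?S. m' s * a s i) = (\<Sum>s\<in>?S. m s * a t j * a s i)"
        by (intro sum.cong) (auto simp: m'_def)
      also have "m' t * a t i = - (\<Sum>s\<in>?S. m s * a s j * a t i)"
        by (simp add: m'_def sum_distrib_right)
      finally show ?thesis
        by (simp add: algebra_simps sum_subtractf)
    qed
    \<comment> \<open>For \<open>i = j\<close> the transformed coefficients vanish identically; for
      the other equations the choice of \<open>m\<close> applies.\<close>
    have "(\<Sum>s\<in>S. m' s * a s i) = 0" if "i \<in> insert j I" for i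
      unfolding sum using m(2) that by (auto simp: mult.commute)
    moreover have "\<exists>s\<in>S. m' s \<noteq> 0"
      using m(1) t by (auto simp: m'_def)
    ultimately show ?thesis by blast
  qed
qed

text \<open>Translates multiplicative relations in \<open>A\<close>, as used in
  \<open>int_independent\<close>, into linear relations between formal integer combinations.\<close>

lemma hom_finprod_int_pow:
  assumes A: "comm_group A" and \<theta>: "\<theta> \<in> hom A (free_Abelian_group I)"
    and S: "finite S" "S \<subseteq> carrier A"
  shows "\<theta> (finprod A (\<lambda>x. x [^]\<^bsub>A\<^esub> (m x :: int)) S) = (\<Sum>x\<in>S. frag_cmul (m x) (\<theta> x))"
proof -
  interpret A: comm_group A by fact
  interpret h: group_hom A "free_Abelian_group I" \<theta>
    by (intro group_hom.intro group_hom_axioms.intro A.group_axioms group_free_Abelian_group \<theta>)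
  show ?thesis
    using S
  proof (induction S rule: finite_induct)
    case empty
    then show ?case using h.hom_one by simp
  next
    case (insert x S)
    then have x: "x \<in> carrier A" and S: "S \<subseteq> carrier A" by auto
    have "Poly_Mapping.keys (\<theta> x) \<subseteq> I"
      using h.hom_closed[OF x] by simp
    moreover have "\<theta> (x [^]\<^bsub>A\<^esub> m x) = \<theta> x [^]\<^bsub>free_Abelian_group I\<^esub> m x"
      using x by (rule h.hom_int_pow)
    ultimately have "\<theta> (x [^]\<^bsub>A\<^esub> m x) = frag_cmul (m x) (\<theta> x)"
      by simp
    moreover have "finprod A (\<lambda>x. x [^]\<^bsub>A\<^esub> m x) (insert x S)
        = x [^]\<^bsub>A\<^esub> m x \<otimes>\<^bsub>A\<^esub> finprod A (\<lambda>x. x [^]\<^bsub>A\<^esub> m x) S"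
      using insert x S by (intro A.finprod_insert) auto
    moreover have "finprod A (\<lambda>x. x [^]\<^bsub>A\<^esub> m x) S \<in> carrier A"
      using S by (intro A.finprod_closed) auto
    ultimately show ?case
      using insert x S by (simp add: h.hom_mult)
  qed
qed

text \<open>Upper bound: the coordinate vectors of more than \<open>card I\<close> elements satisfy
  an integer relation, which injectivity pulls back to \<open>A\<close>. Lower bound: the preimages
  of the basis are independent, so the supremum is attained.\<close>

lemma abelian_rank_iso_free:
  assumes A: "comm_group A" and \<theta>: "\<theta> \<in> iso A (free_Abelian_group I)" and I: "finite I"
  shows "abelian_rank A = enat (card I)"
proof -
  interpret A: comm_group A by fact
  have hom: "\<theta> \<in> hom A (free_Abelian_group I)"
    and bij: "bij_betw \<theta> (carrier A) (carrier (free_Abelian_group I))"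
    using \<theta> by (auto simp: iso_def)
  have \<theta>_one: "\<theta> \<one>\<^bsub>A\<^esub> = 0"
    using hom_one[OF hom] by (simp add: A.is_group)
  have upper: "card S \<le> card I" if S: "int_independent A S" for S
  proof (rule ccontr)
    assume "\<not> card S \<le> card I"
    moreover have fin: "finite S" "S \<subseteq> carrier A"
      using S by (auto simp: int_independent_def)
    ultimately obtain m where m: "\<exists>s\<in>S. m s \<noteq> 0"
        "\<forall>i\<in>I. (\<Sum>s\<in>S. m s * Poly_Mapping.lookup (\<theta> s) i) = 0"
      using exists_integer_relation[OF I, of S "\<lambda>s. Poly_Mapping.lookup (\<theta> s)"] by force
    have closed: "finprod A (\<lambda>x. x [^]\<^bsub>A\<^esub> m x) S \<in> carrier A"
      using fin by (intro A.finprod_closed) auto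
    have keys: "Poly_Mapping.keys (\<theta> s) \<subseteq> I" if "s \<in> S" for s
      using that fin hom_in_carrier[OF hom, of s] by auto
    have "(\<Sum>x\<in>S. frag_cmul (m x) (\<theta> x)) = 0"
    \<comment> \<open>The relation handles the coordinates in \<open>I\<close>; the remaining
      coordinates are zero because the supports lie in \<open>I\<close>.\<close>
    proof (rule poly_mapping_eqI)
      fix i
      show "Poly_Mapping.lookup (\<Sum>x\<in>S. frag_cmul (m x) (\<theta> x)) i = Poly_Mapping.lookup 0 i"
      proof (cases "i \<in> I")
        case True
        then show ?thesis using m by (simp add: lookup_sum)
      next
        case False
        then have "Poly_Mapping.lookup (\<theta> s) i = 0" if "s \<in> S" for s
          using keys[OF that] by (meson in_keys_iff subsetD)
        then show ?thesis by (simp add: lookup_sum)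
      qed
    qed
    then have "\<theta> (finprod A (\<lambda>x. x [^]\<^bsub>A\<^esub> m x) S) = \<theta> \<one>\<^bsub>A\<^esub>"
      using hom_finprod_int_pow[OF A hom fin] by (simp add: \<theta>_one)
    then have "finprod A (\<lambda>x. x [^]\<^bsub>A\<^esub> m x) S = \<one>\<^bsub>A\<^esub>"
      using bij closed by (auto simp: bij_betw_def inj_on_def)
    with S m(1) show False
      by (auto simp: int_independent_def)
  qed
  define e where "e = (\<lambda>i. inv_into (carrier A) \<theta> (frag_of i))"
  have e: "e i \<in> carrier A" "\<theta> (e i) = frag_of i" if "i \<in> I" for i
  proof -
    have "frag_of i \<in> \<theta> ` carrier A"
      using bij that by (simp add: bij_betw_def)
    then show "e i \<in> carrier A" "\<theta> (e i) = frag_of i"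
      by (simp_all add: e_def inv_into_into f_inv_into_f)
  qed
  have inj: "inj_on e I"
    by (metis e(2) frag_of_eq inj_onI)
  have indep: "int_independent A (e ` I)"
    unfolding int_independent_def
  proof (intro conjI allI impI)
    show sub: "finite (e ` I)" "e ` I \<subseteq> carrier A"
      using I e by auto
    fix m :: "'a \<Rightarrow> int"
    assume "finprod A (\<lambda>x. x [^]\<^bsub>A\<^esub> m x) (e ` I) = \<one>\<^bsub>A\<^esub>"
    then have "(\<Sum>x\<in>e ` I. frag_cmul (m x) (\<theta> x)) = 0"
      using hom_finprod_int_pow[OF A hom sub, of m] \<theta>_one by simp
    then have "(\<Sum>i\<in>I. frag_cmul (m (e i)) (frag_of i)) = 0"
      using inj e by (simp add: sum.reindex)
    then have zero: "Poly_Mapping.lookup (\<Sum>i\<in>I. frag_cmul (m (e i)) (frag_of i)) j = 0" for j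
      by simp
    have "m (e j) = 0" if "j \<in> I" for j
    proof -
      have "m (e j) = (\<Sum>i\<in>I. if i = j then m (e i) else 0)"
        using that I by simp
      \<comment> \<open>Distinct basis elements do not interact, so the coordinate at
        \<open>j\<close> isolates a single coefficient.\<close>
      also have "\<dots> = Poly_Mapping.lookup (\<Sum>i\<in>I. frag_cmul (m (e i)) (frag_of i)) j"
        unfolding lookup_sum by (intro sum.cong) auto
      finally show ?thesis
        using zero by simp
    qed
    then show "\<forall>x\<in>e ` I. m x = 0"
      by blast
  qed
  show ?thesis
    unfolding abelian_rank_def
  proof (rule antisym)
    show "(SUP S\<in>{S. int_independent A S}. enat (card S)) \<le> enat (card I)"
      using upper by (intro SUP_least) auto
    have "enat (card (e ` I)) \<le> (SUP S\<in>{S. int_independent A S}. enat (card S))"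
      using indep by (intro SUP_upper) auto
    then show "enat (card I) \<le> (SUP S\<in>{S. int_independent A S}. enat (card S))"
      by (simp add: card_image[OF inj])
  qed
qed

section \<open>First homology of a presented group\<close>

definition bar_boundaries :: "('a, 'm) monoid_scheme \<Rightarrow> ('a list \<Rightarrow>\<^sub>0 int) set" where
  "bar_boundaries G = bar_boundary 2 G ` carrier (bar_chains 2 G)"

text \<open>Both faces of \<open>[g]\<close> are the empty tuple and enter with opposite signs.
  Hence every 1-chain is a cycle, and first homology is chains modulo boundaries.\<close>

lemma bar_boundary_1:
  assumes "z \<in> carrier (bar_chains 1 G)"
  shows "bar_boundary 1 G z = 0"
  unfolding bar_boundary_def
proof (rule frag_extend_eq_0)
  fix gs assume "gs \<in> Poly_Mapping.keys z"
  then have "length gs = 1"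
    using assms by (auto simp: bar_chains_def bar_basis_def)
  then obtain g where "gs = [g]"
    by (auto simp: length_Suc_conv)
  then show "(if (1::nat) = 0 then 0
      else \<Sum>i\<le>1. frag_cmul ((- 1) ^ i) (frag_of (bar_face G 1 i gs))) = 0"
    by (simp add: bar_face_def)
qed

lemma group_homology_1: "group_homology 1 G = bar_chains 1 G Mod bar_boundaries G"
proof -
  have "{z \<in> carrier (bar_chains 1 G). bar_boundary 1 G z = 0} = carrier (bar_chains 1 G)"
    using bar_boundary_1 by blast
  then show ?thesis
    by (simp add: group_homology_def bar_boundaries_def numeral_2_eq_2)
qed

lemma bar_boundary_2_of:
  "bar_boundary 2 G (frag_of [g, h]) = frag_of [h] - frag_of [g \<otimes>\<^bsub>G\<^esub> h] + frag_of [g]"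
  by (simp add: bar_boundary_def bar_face_def numeral_2_eq_2)

lemma bar_boundaries_diff:
  assumes "a \<in> bar_boundaries G" "b \<in> bar_boundaries G"
  shows "a - b \<in> bar_boundaries G"
proof -
  obtain c d where cd: "c \<in> carrier (bar_chains 2 G)" "d \<in> carrier (bar_chains 2 G)"
    "a = bar_boundary 2 G c" "b = bar_boundary 2 G d"
    using assms by (auto simp: bar_boundaries_def)
  then have "c - d \<in> carrier (bar_chains 2 G)"
    using keys_diff[of c d] by (auto simp: bar_chains_def)
  moreover have "a - b = bar_boundary 2 G (c - d)"
    by (simp add: cd bar_boundary_def frag_extend_diff)
  ultimately show ?thesis
    by (simp add: bar_boundaries_def)
qed

lemma bar_boundaries_0: "0 \<in> bar_boundaries G"
  unfolding bar_boundaries_def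
  by (rule image_eqI[of _ _ 0]) (simp_all add: bar_boundary_def bar_chains_def)

lemma bar_boundaries_minus: "a \<in> bar_boundaries G \<Longrightarrow> - a \<in> bar_boundaries G"
  using bar_boundaries_diff[OF bar_boundaries_0] by fastforce

lemma bar_boundaries_add:
  "\<lbrakk>a \<in> bar_boundaries G; b \<in> bar_boundaries G\<rbrakk> \<Longrightarrow> a + b \<in> bar_boundaries G"
  using bar_boundaries_diff[OF _ bar_boundaries_minus, of a G b] by simp

text \<open>The negative of the boundary of \<open>[g, h]\<close>: modulo boundaries, passing from
  an element to its 1-chain turns products into sums.\<close>

lemma bar_boundaries_mult:
  assumes "g \<in> carrier G" "h \<in> carrier G"
  shows "frag_of [g \<otimes>\<^bsub>G\<^esub> h] - frag_of [g] - frag_of [h] \<in> bar_boundaries G"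
proof -
  have "bar_boundary 2 G (frag_of [g, h]) \<in> bar_boundaries G"
    using assms by (auto simp: bar_boundaries_def bar_chains_def bar_basis_def)
  then show ?thesis
    using bar_boundaries_minus by (fastforce simp: bar_boundary_2_of algebra_simps)
qed

text \<open>For \<open>g = h = 1\<close> the product relation reads \<open>[1] - [1] - [1]\<close>,
  which is the negative of the wanted chain.\<close>

lemma bar_boundaries_one:
  assumes "group G"
  shows "frag_of [\<one>\<^bsub>G\<^esub>] \<in> bar_boundaries G"
proof -
  interpret group G by fact
  show ?thesis
    using bar_boundaries_minus[OF bar_boundaries_mult[of "\<one>\<^bsub>G\<^esub>" G "\<one>\<^bsub>G\<^esub>"]] by simp
qed

lemma bar_boundaries_keys:
  assumes "group G" "b \<in> bar_boundaries G"
  shows "b \<in> carrier (bar_chains 1 G)"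
proof -
  interpret group G by fact
  obtain c where c: "Poly_Mapping.keys c \<subseteq> bar_basis 2 G" "b = bar_boundary 2 G c"
    using assms(2) by (auto simp: bar_boundaries_def bar_chains_def)
  from c(1) have "bar_boundary 2 G c \<in> carrier (bar_chains 1 G)"
  proof (induction c rule: frag_induction)
    case zero
    then show ?case by (simp add: bar_boundary_def bar_chains_def)
  next
    case (one gs)
    then obtain g h where gs: "gs = [g, h]" "g \<in> carrier G" "h \<in> carrier G"
      by (auto simp: bar_basis_def numeral_2_eq_2 length_Suc_conv)
    let ?K = "{[g], [h], [g \<otimes>\<^bsub>G\<^esub> h]}"
    have "Poly_Mapping.keys (frag_of [h] - frag_of [g \<otimes>\<^bsub>G\<^esub> h] + frag_of [g]) \<subseteq> ?K"
      using keys_add[of "frag_of [h] - frag_of [g \<otimes>\<^bsub>G\<^esub> h]" "frag_of [g]"]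
        keys_diff[of "frag_of [h]" "frag_of [g \<otimes>\<^bsub>G\<^esub> h]"] by auto
    moreover have "?K \<subseteq> bar_basis 1 G"
      using gs by (auto simp: bar_basis_def)
    ultimately show ?case
      by (auto simp: gs(1) bar_boundary_2_of bar_chains_def)
  next
    case (diff a b)
    then show ?case
      using keys_diff[of "bar_boundary 2 G a" "bar_boundary 2 G b"]
      by (auto simp: bar_boundary_def bar_chains_def frag_extend_diff)
  qed
  with c show ?thesis by simp
qed

section \<open>Words as 1-chains modulo boundaries\<close>

context presentation
begin

abbreviation gclass :: "'a \<Rightarrow> 'a word set set" where
  "gclass x \<equiv> pclass X R [(x, True)]"

text \<open>For an inverse letter, the product with its generator is the identity, whose 1-chain is
  a boundary; so the two chains are opposite modulo boundaries.\<close>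

lemma frag_of_letter:
  assumes "x \<in> X"
  shows "frag_of [pclass X R [(x, s)]] - (if s then frag_of [gclass x] else - frag_of [gclass x])
    \<in> bar_boundaries P"
proof (cases s)
  case False
  have "pclass X R ([(x, False)] @ [(x, True)]) = \<one>\<^bsub>P\<^esub>"
  proof -
    have "word_class X [(x, False), (x, True)] = word_class X []"
      using free_rel_winv_left[of "[(x, True)]" X] assms by (simp add: word_class_eq_iff)
    then show ?thesis by (simp add: one_P pclass_def)
  qed
  then have "pclass X R [(x, False)] \<otimes>\<^bsub>P\<^esub> gclass x = \<one>\<^bsub>P\<^esub>"
    using assms by (subst mult_P) auto
  then have "frag_of [\<one>\<^bsub>P\<^esub>] - frag_of [pclass X R [(x, False)]] - frag_of [gclass x] \<in> bar_boundaries P"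
    using bar_boundaries_mult[of "pclass X R [(x, False)]" P "gclass x"] assms by simp
  from bar_boundaries_diff[OF bar_boundaries_one[OF group_P] this] False show ?thesis
    by (simp add: algebra_simps)
qed (simp add: bar_boundaries_0)

text \<open>Splitting off one letter at a time by the product relation shows that the chain of a
  group element depends, modulo boundaries, only on the exponents of a representing word.\<close>

lemma frag_of_pclass:
  assumes "w \<in> words X"
  shows "frag_of [pclass X R w] - word_value (\<lambda>x. frag_of [gclass x]) w \<in> bar_boundaries P"
  using assms
proof (induction w)
  case Nil
  then show ?case
    using bar_boundaries_one[OF group_P] by (simp add: one_P)
next
  case (Cons a w)
  obtain x s where a: "a = (x, s)" by force
  with Cons.prems have x: "x \<in> X" and w: "w \<in> words X" by auto
  have "pclass X R (a # w) = pclass X R [(x, s)] \<otimes>\<^bsub>P\<^esub> pclass X R w"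
    using x w by (subst mult_P) (auto simp: a)
  then have "frag_of [pclass X R (a # w)] - frag_of [pclass X R [(x, s)]] - frag_of [pclass X R w]
      \<in> bar_boundaries P"
    using x w by (simp add: bar_boundaries_mult)
  from bar_boundaries_add[OF bar_boundaries_add[OF this frag_of_letter[OF x, of s]] Cons.IH[OF w]]
  show ?case
    by (cases s) (simp_all add: a algebra_simps)
qed

text \<open>The assumptions say that every relator has exponent sum zero in each generator from \<open>I\<close>, and that
  each of the remaining generators is, up to commutators, a product of relators.\<close>

lemma betti_number_1_presented:
  assumes I: "finite I" "I \<subseteq> X"
    and rel: "\<And>(v :: 'a \<Rightarrow> ('a \<Rightarrow>\<^sub>0 int)) w. \<lbrakk>\<And>x. x \<notin> I \<Longrightarrow> v x = 0; w \<in> R\<rbrakk> \<Longrightarrow> word_value v w = 0"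
    and kill: "\<And>x. x \<in> X - I \<Longrightarrow> \<exists>ws\<in>lists R. word_value frag_of (concat ws) = frag_of x"
  shows "betti_number 1 P = enat (card I)"
proof -
  let ?B = "bar_boundaries P"
  define v :: "'a \<Rightarrow> ('a \<Rightarrow>\<^sub>0 int)" where "v = (\<lambda>x. if x \<in> I then frag_of x else 0)"
  \<comment> \<open>A representative is chosen arbitrarily; the value does not depend on it, since
    \<open>v\<close> vanishes on the relators.\<close>
  define \<phi> where "\<phi> = (\<lambda>g. word_value v (SOME w. w \<in> words X \<and> pclass X R w = g))"
  \<comment> \<open>\<open>\<Phi>\<close> is the linear extension to 1-chains, where
    \<open>hd\<close> unpacks one-element tuples. \<open>\<Psi>\<close> sends each basis element
    back to the chain of its generator.\<close>
  define \<Phi> where "\<Phi> = frag_extend (\<lambda>gs. \<phi> (hd gs))"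
  define \<Psi> where "\<Psi> = frag_extend (\<lambda>x. frag_of [gclass x])"
  have v_rel: "word_value v w = 0" if "w \<in> R" for w
    using that by (intro rel) (auto simp: v_def)
  have \<phi>: "\<phi> (pclass X R w) = word_value v w" if w: "w \<in> words X" for w
  proof -
    have "\<exists>u. u \<in> words X \<and> pclass X R u = pclass X R w"
      using w by blast
    from someI_ex[OF this] show ?thesis
      unfolding \<phi>_def using w v_rel by (intro word_value_pclass_cong) auto
  qed
  have \<phi>_mult: "\<phi> (g \<otimes>\<^bsub>P\<^esub> h) = \<phi> g + \<phi> h" if "g \<in> carrier P" "h \<in> carrier P" for g h
    using that by (auto simp: carrier_P mult_P \<phi>)
  have keys_\<phi>: "Poly_Mapping.keys (\<phi> g) \<subseteq> I" for g
    unfolding \<phi>_def by (rule keys_word_value) (simp add: v_def)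
  have hom: "\<Phi> \<in> hom (bar_chains 1 P) (free_Abelian_group I)"
  proof (rule homI)
    fix z
    show "\<Phi> z \<in> carrier (free_Abelian_group I)"
      using keys_frag_extend[of "\<lambda>gs. \<phi> (hd gs)" z] keys_\<phi> unfolding \<Phi>_def by fastforce
  qed (simp add: \<Phi>_def bar_chains_def frag_extend_add)
  have \<Psi>_closed: "\<Psi> y \<in> carrier (bar_chains 1 P)" if "Poly_Mapping.keys y \<subseteq> I" for y
    using keys_frag_extend[of "\<lambda>x. frag_of [gclass x]" y] that I(2)
    unfolding \<Psi>_def bar_chains_def bar_basis_def by fastforce
  \<comment> \<open>\<open>\<Psi>\<close> is a section of \<open>\<Phi>\<close>, which yields
    surjectivity.\<close>
  have \<Phi>_\<Psi>: "\<Phi> (\<Psi> y) = y" if "Poly_Mapping.keys y \<subseteq> I" for y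
    using that
  proof (induction y rule: frag_induction)
    case (one x)
    then have "x \<in> X" using I by auto
    with one show ?case by (simp add: \<Phi>_def \<Psi>_def \<phi> v_def)
  qed (simp_all add: \<Phi>_def \<Psi>_def frag_extend_diff)
  have surj: "\<Phi> ` carrier (bar_chains 1 P) = carrier (free_Abelian_group I)"
  proof
    show "carrier (free_Abelian_group I) \<subseteq> \<Phi> ` carrier (bar_chains 1 P)"
      using \<Phi>_\<Psi> \<Psi>_closed by (metis carrier_free_Abelian_group_iff image_eqI subsetI)
  qed (use hom in \<open>auto simp: hom_def\<close>)
  \<comment> \<open>A product of relators represents the identity, so its letter sum is a boundary;
    by \<open>kill\<close> that sum can be made the single generator \<open>x\<close>.\<close>
  have killed: "frag_of [gclass x] \<in> ?B" if x: "x \<in> X - I" for x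
  proof -
    obtain ws where ws: "ws \<in> lists R" "word_value frag_of (concat ws) = frag_of x"
      using kill[OF x] by blast
    have "word_value (\<lambda>x. frag_of [gclass x]) (concat ws)
        = frag_extend (\<lambda>x. frag_of [gclass x]) (word_value frag_of (concat ws))"
      by (simp add: frag_extend_word_value)
    also have "\<dots> = frag_of [gclass x]"
      by (simp add: ws(2))
    finally have "frag_of [\<one>\<^bsub>P\<^esub>] - frag_of [gclass x] \<in> ?B"
      using frag_of_pclass[of "concat ws"] pclass_concat_relators[OF ws(1)] by simp
    from bar_boundaries_diff[OF bar_boundaries_one[OF group_P] this] show ?thesis
      by simp
  qed
  \<comment> \<open>Applying \<open>\<Psi>\<close> after \<open>v\<close> keeps the letters from
    \<open>I\<close> and drops the others, whose chains are boundaries by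
    \<open>killed\<close>.\<close>
  have word: "word_value (\<lambda>x. frag_of [gclass x]) w - \<Psi> (word_value v w) \<in> ?B"
    if "w \<in> words X" for w
    using that
  proof (induction w)
    case Nil
    then show ?case by (simp add: \<Psi>_def bar_boundaries_0)
  next
    case (Cons a w)
    obtain x s where a: "a = (x, s)" by force
    with Cons.prems have x: "x \<in> X" and w: "w \<in> words X" by auto
    define e where "e = (if s then frag_of [gclass x] - \<Psi> (v x) else \<Psi> (v x) - frag_of [gclass x])"
    have d: "frag_of [gclass x] - \<Psi> (v x) \<in> ?B"
      using x killed by (auto simp: \<Psi>_def v_def bar_boundaries_0)
    have "e \<in> ?B"
      using d bar_boundaries_minus[OF d] by (auto simp: e_def)
    from bar_boundaries_add[OF this Cons.IH[OF w]] show ?case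
      by (cases s)
        (simp_all add: a e_def \<Psi>_def frag_extend_add frag_extend_diff frag_extend_minus algebra_simps)
  qed
  \<comment> \<open>\<open>\<Psi>\<close> also inverts \<open>\<Phi>\<close> up to boundaries, so a
    chain with \<open>\<Phi> z = 0\<close> is itself a boundary.\<close>
  have retract: "z - \<Psi> (\<Phi> z) \<in> ?B" if "Poly_Mapping.keys z \<subseteq> bar_basis 1 P" for z
    using that
  proof (induction z rule: frag_induction)
    case zero
    then show ?case by (simp add: \<Phi>_def \<Psi>_def bar_boundaries_0)
  next
    case (one gs)
    then obtain w where w: "w \<in> words X" "gs = [pclass X R w]"
      by (auto simp: bar_basis_def carrier_P length_Suc_conv)
    from bar_boundaries_add[OF frag_of_pclass[OF w(1)] word[OF w(1)]] show ?case
      by (simp add: \<Phi>_def w \<phi>)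
  next
    case (diff a b)
    from bar_boundaries_diff[OF this(1,2)] show ?case
      by (simp add: \<Phi>_def \<Psi>_def frag_extend_diff algebra_simps)
  qed
  have \<Phi>_boundary: "\<Phi> (bar_boundary 2 P c) = 0" if "Poly_Mapping.keys c \<subseteq> bar_basis 2 P" for c
    using that
  proof (induction c rule: frag_induction)
    case (one gs)
    then obtain g h where "gs = [g, h]" "g \<in> carrier P" "h \<in> carrier P"
      by (auto simp: bar_basis_def numeral_2_eq_2 length_Suc_conv)
    then show ?case
      by (simp add: bar_boundary_2_of \<Phi>_def frag_extend_add frag_extend_diff \<phi>_mult)
  qed (simp_all add: bar_boundary_def \<Phi>_def frag_extend_diff)
  have kernel: "kernel (bar_chains 1 P) (free_Abelian_group I) \<Phi> = ?B"
  proof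
    show "kernel (bar_chains 1 P) (free_Abelian_group I) \<Phi> \<subseteq> ?B"
    proof
      fix z assume "z \<in> kernel (bar_chains 1 P) (free_Abelian_group I) \<Phi>"
      then have "Poly_Mapping.keys z \<subseteq> bar_basis 1 P" "\<Phi> z = 0"
        by (auto simp: kernel_def bar_chains_def)
      with retract[of z] show "z \<in> ?B"
        by (simp add: \<Psi>_def)
    qed
    show "?B \<subseteq> kernel (bar_chains 1 P) (free_Abelian_group I) \<Phi>"
    proof
      fix b assume b: "b \<in> ?B"
      then have "\<Phi> b = 0"
        using \<Phi>_boundary by (auto simp: bar_boundaries_def bar_chains_def)
      then show "b \<in> kernel (bar_chains 1 P) (free_Abelian_group I) \<Phi>"
        using bar_boundaries_keys[OF group_P b] by (simp add: kernel_def)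
    qed
  qed
  have comm: "comm_group (bar_chains 1 P)"
    unfolding bar_chains_def by (rule abelian_free_Abelian_group)
  interpret h: group_hom "bar_chains 1 P" "free_Abelian_group I" \<Phi>
    by (intro group_hom.intro group_hom_axioms.intro hom group_free_Abelian_group comm_group.axioms(2)[OF comm])
  have H: "group_homology 1 P = bar_chains 1 P Mod kernel (bar_chains 1 P) (free_Abelian_group I) \<Phi>"
    by (simp only: group_homology_1 kernel)
  have "comm_group (group_homology 1 P)"
    unfolding H by (intro comm_group.abelian_FactGroup[OF comm] h.subgroup_kernel)
  \<comment> \<open>First isomorphism theorem for the surjection \<open>\<Phi>\<close>, whose kernel
    is the group of boundaries.\<close>
  moreover have "(\<lambda>C. the_elem (\<Phi> ` C)) \<in> iso (group_homology 1 P) (free_Abelian_group I)"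
    unfolding H by (rule h.FactGroup_iso_set[OF surj])
  ultimately show ?thesis
    unfolding betti_number_def using I(1) by (rule abelian_rank_iso_free)
qed

end

section \<open>The groups \<open>K r\<close>\<close>

lemma words_V_word:
  assumes "Gen_d \<in> X"
  shows "V_word i j \<in> words X"
  using assms words_wpow[of dd X] by (auto simp: V_word_def)

lemma words_W_word:
  assumes "Gen_d \<in> X" "Gen_f i 2 \<in> X" "Gen_c j \<in> X"
  shows "W_word i j \<in> words X"
  using assms words_wpow[of dd X] by (auto simp: W_word_def)

lemma word_value_V_word: "v Gen_d = 0 \<Longrightarrow> word_value v (V_word i j) = 0"
  by (simp add: V_word_def word_value_wpow_eq_0)

lemma word_value_W_word: "v Gen_d = 0 \<Longrightarrow> word_value v (W_word i j) = 0"
  by (simp add: W_word_def word_value_wpow_eq_0)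

text \<open>The exponent \<open>2 * i - 3\<close> is -1 for \<open>i = 1\<close> and 1 for
  \<open>i = 2\<close>. The index one is written \<open>Suc 0\<close> to match its simplified
  form.\<close>

lemma word_value_V_word_off_diagonal:
  "word_value v (V_word (Suc 0) 2) = - v Gen_d" "word_value v (V_word 2 (Suc 0)) = v Gen_d"
  by (simp_all add: V_word_def wpow_def)

lemma wpow_sign: "wpow w 1 = w" "wpow w (- 1) = winv w"
  by (simp_all add: wpow_def)

lemma gens_ge4_iff [simp]:
  "Gen_c i \<in> gens_ge4 r \<longleftrightarrow> i \<in> {1, 2}"
  "Gen_d \<in> gens_ge4 r"
  "Gen_f i k \<in> gens_ge4 r \<longleftrightarrow> i \<in> {1, 2} \<and> k \<in> {2..r}"
  "Gen_g i k \<in> gens_ge4 r \<longleftrightarrow> i \<in> {1, 2} \<and> k \<in> {2..r}"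
  by (auto simp: gens_ge4_def)

lemma rels_ge4_words:
  assumes "r \<ge> 2"
  shows "rels_ge4 r \<subseteq> words (gens_ge4 r)"
  using assms unfolding rels_ge4_def S_word_def T_word_def
  by (auto simp: wpow_sign intro!: words_V_word words_W_word)

text \<open>Commutators contribute nothing, and every generator other than \<open>d\<close> occurs
  in each relator equally often with either sign. Only powers of \<open>d\<close> remain.\<close>

lemma word_value_rels_ge4:
  assumes "v Gen_d = 0" "w \<in> rels_ge4 r"
  shows "word_value v w = 0"
  using assms unfolding rels_ge4_def S_word_def T_word_def
  by (auto simp: wpow_sign word_value_V_word word_value_W_word)

text \<open>There are two generators \<open>c\<close>, and \<open>2 * (r - 1)\<close> of each of the
  kinds \<open>f\<close> and \<open>g\<close>, since the upper index starts at 2.\<close>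

lemma card_gens_ge4:
  assumes "r \<ge> 2"
  shows "finite (gens_ge4 r)" "card (gens_ge4 r - {Gen_d}) = 4 * r - 2"
proof -
  let ?J = "{1, 2} \<times> {2..r}"
  have eq: "gens_ge4 r - {Gen_d} =
      Gen_c ` {1, 2} \<union> (\<lambda>(i, k). Gen_f i k) ` ?J \<union> (\<lambda>(i, k). Gen_g i k) ` ?J"
    by (auto simp: gens_ge4_def)
  have "finite (gens_ge4 r - {Gen_d})"
    unfolding eq by simp
  then show "finite (gens_ge4 r)" by simp
  have "card (Gen_c ` {1, 2}) = 2" "card ((\<lambda>(i, k). Gen_f i k) ` ?J) = 2 * (r - 1)"
    "card ((\<lambda>(i, k). Gen_g i k) ` ?J) = 2 * (r - 1)"
    by (subst card_image, auto simp: inj_on_def)+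
  moreover have "card (gens_ge4 r - {Gen_d}) = card (Gen_c ` {1, 2})
      + card ((\<lambda>(i, k). Gen_f i k) ` ?J) + card ((\<lambda>(i, k). Gen_g i k) ` ?J)"
    unfolding eq by (subst card_Un_disjoint, (auto)[3])+ simp
  ultimately show "card (gens_ge4 r - {Gen_d}) = 4 * r - 2"
    using assms by simp
qed

lemma gens_3_eq:
  "gens_3 = {Gen_x 1, Gen_x 2, Gen_c 1, Gen_c 2, Gen_d, Gen_f 1 2, Gen_f 2 2, Gen_g 1 2, Gen_g 2 2,
     Gen_c3 1, Gen_c3 2, Gen_delta}"
  by (auto simp: gens_3_def A_gens_def B_gens_def)

lemma rels_3_words: "rels_3 \<subseteq> words gens_3"
proof -
  have "A_gens \<subseteq> gens_3" "B_gens \<subseteq> gens_3"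
    by (auto simp: gens_3_def)
  moreover have "wpow delta (- 2) \<in> words gens_3"
    by (intro words_wpow) (simp add: gens_3_eq)
  ultimately show ?thesis
    unfolding rels_3_def S_word_def T_word_def
    by (auto simp: wpow_sign gens_3_eq intro!: words_V_word words_W_word)
qed

text \<open>As for larger \<open>r\<close>, except that \<delta> also survives: once in the relator
  of \<open>[x_1, x_2]\<close> and with exponent -2 in the last relator.\<close>

lemma word_value_rels_3:
  assumes "v Gen_d = 0" "v Gen_delta = 0" "w \<in> rels_3"
  shows "word_value v w = 0"
proof -
  have "word_value v (wpow delta (- 2)) = 0"
    using assms by (intro word_value_wpow_eq_0) simp
  then show ?thesis
    using assms unfolding rels_3_def S_word_def T_word_def
    by (auto simp: wpow_sign word_value_V_word word_value_W_word)
qed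

theorem corollary1p2:
  fixes r :: nat
  assumes "r \<ge> 3"
  shows "betti_number 1 (K r) = enat (4 * r - 2)"
proof (cases "r = 3")
  case True
  interpret presentation gens_3 rels_3
    by unfold_locales (rule rels_3_words)
  let ?I = "gens_3 - {Gen_d, Gen_delta}"
  \<comment> \<open>The exponent sums of these relators are \<open>d\<close> for \<open>?d\<close>,
    \<open>- d\<close> for \<open>?d'\<close> and \<open>\<delta> + d\<close> for
    \<open>?delta\<close>. Hence \<open>?d\<close> kills \<open>d\<close>, and \<open>?delta\<close>
    followed by \<open>?d'\<close> kills \<delta>.\<close>
  let ?d = "wcomm (xx 1) (ff 2 2) @ winv (V_word 1 2)"
  let ?d' = "wcomm (xx 2) (ff 1 2) @ winv (V_word 2 1)"
  let ?delta = "wcomm (xx 1) (xx 2) @ delta @ dd"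
  have rels: "?d \<in> rels_3" "?d' \<in> rels_3" "?delta \<in> rels_3"
    unfolding rels_3_def by blast+
  have "betti_number 1 P = enat (card ?I)"
  proof (rule betti_number_1_presented)
    fix x assume "x \<in> gens_3 - ?I"
    then consider "x = Gen_d" | "x = Gen_delta" by blast
    then show "\<exists>ws\<in>lists rels_3. word_value frag_of (concat ws) = frag_of x"
    proof cases
      case 1
      then show ?thesis
        using rels by (intro bexI[of _ "[?d]"]) (simp_all add: word_value_V_word_off_diagonal)
    next
      case 2
      then show ?thesis
        using rels by (intro bexI[of _ "[?delta, ?d']"]) (simp_all add: word_value_V_word_off_diagonal)
    qed
  qed (auto simp: gens_3_eq intro!: word_value_rels_3)
  \<comment> \<open>These ten generators match \<open>4 * 3 - 2\<close>.\<close>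
  moreover have "?I = {Gen_x 1, Gen_x 2, Gen_c 1, Gen_c 2, Gen_f 1 2, Gen_f 2 2, Gen_g 1 2, Gen_g 2 2,
      Gen_c3 1, Gen_c3 2}"
    by (auto simp: gens_3_eq)
  ultimately show ?thesis
    by (simp add: K_def True)
next
  case False
  with assms have r: "r \<ge> 4" by simp
  interpret presentation "gens_ge4 r" "rels_ge4 r"
    by unfold_locales (use r in \<open>simp add: rels_ge4_words\<close>)
  \<comment> \<open>The commutator relator requires distinct upper indices; 2 and 3 are available,
    and the exponent sum is exactly \<open>d\<close>.\<close>
  let ?d = "wcomm (ff 1 2) (ff 2 3) @ winv (V_word 1 2)"
  have "1 \<in> {1, 2::nat} \<and> 2 \<in> {1, 2::nat} \<and> 2 \<in> {2..r} \<and> 3 \<in> {2..r} \<and> (3::nat) \<noteq> 2"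
    using r by simp
  then have rels: "?d \<in> rels_ge4 r"
    unfolding rels_ge4_def by blast
  have "betti_number 1 P = enat (card (gens_ge4 r - {Gen_d}))"
  proof (rule betti_number_1_presented)
    fix x assume "x \<in> gens_ge4 r - (gens_ge4 r - {Gen_d})"
    then have "x = Gen_d" by blast
    then show "\<exists>ws\<in>lists (rels_ge4 r). word_value frag_of (concat ws) = frag_of x"
      using rels by (intro bexI[of _ "[?d]"]) (simp_all add: word_value_V_word_off_diagonal)
  qed (use r in \<open>auto simp: card_gens_ge4 intro: word_value_rels_ge4\<close>)
  also have "card (gens_ge4 r - {Gen_d}) = 4 * r - 2"
    using r by (intro card_gens_ge4) simp
  finally show ?thesis
    by (simp only: K_def False if_False)
qed

end
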